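(* Let $D$ be a set, let $A$ and $B$ be subsets of $D$ of cardinality $|A|=|B|\ge 2$, let $c\in A\cap B$, and let $a\in A$, $b\in B$ be different elements such that $A\setminus\{a\}=B\setminus\{b\}$. Define binary operations on $D$ by $$x\dashv y=\begin{cases}x,&\text{if } x\in A,\\ c,&\text{if } x\in D\setminus A,\end{cases}\qquad x\vdash y=\begin{cases}y,&\text{if } y\in B,\\ c,&\text{if } y\in D\setminus B.\end{cases}$$ Then $(D,\dashv,\vdash)$ is an iso-dual, nonabelian, noncommutative, rectangular dimonoid with empty halo, and $$\mathrm{Aut}(D,\dashv,\vdash)\cong S_{A\setminus\{a,c\}}\times S_{D\setminus(A\cup B)}.$$
   Context: A dimonoid is a set $D$ with two associative binary operations $\dashv,\vdash$ satisfying, for all $x,y,z\in D$: $(D_1)$ $(x\dashv y)\dashv z=x\dashv(y\vdash z)$; $(D_2)$ $(x\vdash y)\dashv z=x\vdash(y\dashv z)$; $(D_3)$ $(x\dashv y)\vdash z=x\vdash(y\vdash z)$. A dimonoid is commutative if both $\dashv$ and $\vdash$ are commutative (noncommutative means not commutative). It is abelian if $x\dashv y=y\vdash x$ for all $x,y$ (nonabelian means not abelian). It is rectangular if both semigroups $(D,\dashv)$ and $(D,\vdash)$ are rectangular, where a semigroup $(S,* )$ is rectangular if $x*y*z=x*z$ for all $x,y,z\in S$. The dual dimonoid of $(D,\dashv,\vdash)$ is $(D,\dashv^d,\vdash^d)$ with $x\dashv^d y=y\vdash x$ and $x\vdash^d y=y\dashv x$. A dimonoid is iso-dual if it is isomorphic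 to its dual dimonoid. An isomorphism of dimonoids is a bijection preserving both operations; $\mathrm{Aut}(D,\dashv,\vdash)$ is the group of isomorphisms from the dimonoid to itself. The halo of a dimonoid is the set of its bar-units, i.e. elements $e$ with $e\vdash d=d=d\dashv e$ for all $d\in D$. $S_X$ denotes the group of all permutations of the set $X$ (the trivial group if $X=\emptyset$). *)

theory Defs
  imports "HOL-Algebra.Bij" "HOL-Library.Equipollence"
begin

record 'a dimonoid = "'a partial_object" +
  ldash :: "'a \<Rightarrow> 'a \<Rightarrow> 'a" (infixl \<open>\<stileturn>\<index>\<close> 70)
  rdash :: "'a \<Rightarrow> 'a \<Rightarrow> 'a" (infixl \<open>\<turnstile>\<index>\<close> 70)

locale dimonoid =
  fixes D (structure)
  assumes ldash_closed: "\<lbrakk>x \<in> carrier D; y \<in> carrier D\<rbrakk> \<Longrightarrow> x \<stileturn> y \<in> carrier D"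
    and rdash_closed: "\<lbrakk>x \<in> carrier D; y \<in> carrier D\<rbrakk> \<Longrightarrow> x \<turnstile> y \<in> carrier D"
    and ldash_assoc: "\<lbrakk>x \<in> carrier D; y \<in> carrier D; z \<in> carrier D\<rbrakk>
          \<Longrightarrow> (x \<stileturn> y) \<stileturn> z = x \<stileturn> (y \<stileturn> z)"
    and rdash_assoc: "\<lbrakk>x \<in> carrier D; y \<in> carrier D; z \<in> carrier D\<rbrakk>
          \<Longrightarrow> (x \<turnstile> y) \<turnstile> z = x \<turnstile> (y \<turnstile> z)"
    and D1: "\<lbrakk>x \<in> carrier D; y \<in> carrier D; z \<in> carrier D\<rbrakk>
          \<Longrightarrow> (x \<stileturn> y) \<stileturn> z = x \<stileturn> (y \<turnstile> z)"
    and D2: "\<lbrakk>x \<in> carrier D; y \<in> carrier D; z \<in> carrier D\<rbrakk>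
          \<Longrightarrow> (x \<turnstile> y) \<stileturn> z = x \<turnstile> (y \<stileturn> z)"
    and D3: "\<lbrakk>x \<in> carrier D; y \<in> carrier D; z \<in> carrier D\<rbrakk>
          \<Longrightarrow> (x \<stileturn> y) \<turnstile> z = x \<turnstile> (y \<turnstile> z)"

definition commutative_on :: "'a set \<Rightarrow> ('a \<Rightarrow> 'a \<Rightarrow> 'a) \<Rightarrow> bool" where
  "commutative_on S f \<longleftrightarrow> (\<forall>x\<in>S. \<forall>y\<in>S. f x y = f y x)"

definition rectangular_on :: "'a set \<Rightarrow> ('a \<Rightarrow> 'a \<Rightarrow> 'a) \<Rightarrow> bool" where
  "rectangular_on S f \<longleftrightarrow> (\<forall>x\<in>S. \<forall>y\<in>S. \<forall>z\<in>S. f (f x y) z = f x z)"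

text \<open>
  The following properties are meant for structures satisfying \<^locale>\<open>dimonoid\<close>, which is
  not repeated in them: their negations are to be read as statements about a given dimonoid.
\<close>

definition dimonoid_commutative :: "('a, 'm) dimonoid_scheme \<Rightarrow> bool" where
  "dimonoid_commutative D \<longleftrightarrow>
     commutative_on (carrier D) (ldash D) \<and> commutative_on (carrier D) (rdash D)"

definition dimonoid_abelian :: "('a, 'm) dimonoid_scheme \<Rightarrow> bool" where
  "dimonoid_abelian D \<longleftrightarrow> (\<forall>x\<in>carrier D. \<forall>y\<in>carrier D. x \<stileturn>\<^bsub>D\<^esub> y = y \<turnstile>\<^bsub>D\<^esub> x)"

definition dimonoid_rectangular :: "('a, 'm) dimonoid_scheme \<Rightarrow> bool" where
  "dimonoid_rectangular D \<longleftrightarrow>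
     rectangular_on (carrier D) (ldash D) \<and> rectangular_on (carrier D) (rdash D)"

definition halo :: "('a, 'm) dimonoid_scheme \<Rightarrow> 'a set" where
  "halo D = {e \<in> carrier D. \<forall>d\<in>carrier D. e \<turnstile>\<^bsub>D\<^esub> d = d \<and> d = d \<stileturn>\<^bsub>D\<^esub> e}"

definition dual_dimonoid :: "('a, 'm) dimonoid_scheme \<Rightarrow> 'a dimonoid" where
  "dual_dimonoid D =
     \<lparr>carrier = carrier D,
      ldash = (\<lambda>x y. y \<turnstile>\<^bsub>D\<^esub> x),
      rdash = (\<lambda>x y. y \<stileturn>\<^bsub>D\<^esub> x)\<rparr>"

definition dimonoid_iso ::
    "('a, 'm) dimonoid_scheme \<Rightarrow> ('b, 'n) dimonoid_scheme \<Rightarrow> ('a \<Rightarrow> 'b) set" where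
  "dimonoid_iso D E =
     {f. bij_betw f (carrier D) (carrier E) \<and>
         (\<forall>x\<in>carrier D. \<forall>y\<in>carrier D.
            f (x \<stileturn>\<^bsub>D\<^esub> y) = f x \<stileturn>\<^bsub>E\<^esub> f y \<and> f (x \<turnstile>\<^bsub>D\<^esub> y) = f x \<turnstile>\<^bsub>E\<^esub> f y)}"

definition iso_dual :: "('a, 'm) dimonoid_scheme \<Rightarrow> bool" where
  "iso_dual D \<longleftrightarrow> dimonoid_iso D (dual_dimonoid D) \<noteq> {}"

text \<open>
  As with \<^const>\<open>AutoGroup\<close>, automorphisms are extensional functions, so that each automorphism
  of the carrier is counted once; the group operation is composition.
\<close>

definition DimonoidAut :: "('a, 'm) dimonoid_scheme \<Rightarrow> ('a \<Rightarrow> 'a) monoid" where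
  "DimonoidAut D =
     BijGroup (carrier D) \<lparr>carrier := dimonoid_iso D D \<inter> extensional (carrier D)\<rparr>"

lemma (in dimonoid) dimonoid_dual: "dimonoid (dual_dimonoid D)"
  by unfold_locales
    (simp_all add: dual_dimonoid_def ldash_closed rdash_closed ldash_assoc rdash_assoc
      D1 D2 D3 flip: ldash_assoc rdash_assoc)

lemma (in dimonoid) group_DimonoidAut: "group (DimonoidAut D)"
proof -
  let ?C = "carrier D" and ?A = "dimonoid_iso D D \<inter> extensional (carrier D)"
  have sub: "?A \<subseteq> Bij ?C"
    by (auto simp: dimonoid_iso_def Bij_def)
  have "subgroup ?A (BijGroup ?C)"
  proof (rule subgroup.intro)
    show "?A \<subseteq> carrier (BijGroup ?C)"
      using sub by (simp add: BijGroup_def)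
  next
    fix f g assume fg: "f \<in> ?A" "g \<in> ?A"
    then have B: "f \<in> Bij ?C" "g \<in> Bij ?C" using sub by auto
    have gC: "g x \<in> ?C" if "x \<in> ?C" for x
      using B(2) that by (auto simp: Bij_def bij_betw_def)
    have "compose ?C f g \<in> ?A"
      using compose_Bij[OF B] fg gC
      by (auto simp: dimonoid_iso_def Bij_def compose_def ldash_closed rdash_closed)
    then show "f \<otimes>\<^bsub>BijGroup ?C\<^esub> g \<in> ?A"
      using B by (simp add: BijGroup_def)
  next
    show "\<one>\<^bsub>BijGroup ?C\<^esub> \<in> ?A"
      using id_Bij[of ?C]
      by (auto simp: BijGroup_def dimonoid_iso_def Bij_def ldash_closed rdash_closed)
  next
    fix f assume f: "f \<in> ?A"
    then have B: "f \<in> Bij ?C" using sub by auto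
    have "restrict (inv_into ?C f) ?C \<in> ?A"
    proof -
      have l: "inv_into ?C f (x \<stileturn> y) = inv_into ?C f x \<stileturn> inv_into ?C f y"
        if "x \<in> ?C" "y \<in> ?C" for x y
        by (rule Bij_inv_into_lemma[OF _ B])
          (use f that in \<open>auto simp: dimonoid_iso_def ldash_closed\<close>)
      have r: "inv_into ?C f (x \<turnstile> y) = inv_into ?C f x \<turnstile> inv_into ?C f y"
        if "x \<in> ?C" "y \<in> ?C" for x y
        by (rule Bij_inv_into_lemma[OF _ B])
          (use f that in \<open>auto simp: dimonoid_iso_def rdash_closed\<close>)
      show ?thesis
        using restrict_inv_into_Bij[OF B] l r
        by (auto simp: dimonoid_iso_def Bij_def ldash_closed rdash_closed)
    qed
    then show "inv\<^bsub>BijGroup ?C\<^esub> f \<in> ?A"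
      using B by (simp add: inv_BijGroup)
  qed
  then show ?thesis
    unfolding DimonoidAut_def
    by (rule subgroup.subgroup_is_group[OF _ group_BijGroup])
qed

end

theory Submission
  imports Defs "HOL-Combinatorics.Transposition"
begin

text \<open>
  Write \<open>f x = x \<stileturn> y\<close> and \<open>g y = x \<turnstile> y\<close>: these are commuting retractions onto \<open>A\<close> and \<open>B\<close> which
  send everything else to \<open>c\<close>, and all identities concern only \<open>f\<close> and \<open>g\<close>. Since \<open>A\<close> and \<open>B\<close> differ
  exactly in \<open>a\<close> and \<open>b\<close>, the transposition of \<open>a\<close> and \<open>b\<close> exchanges \<open>f\<close> with \<open>g\<close>. A bijection
  commutes with \<open>f\<close> and \<open>g\<close> iff it fixes \<open>a\<close>, \<open>b\<close>, \<open>c\<close> and preserves the other two parts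
  \<open>A - {a, c}\<close> and \<open>D - (A \<union> B)\<close> of \<open>D\<close>.
\<close>

text \<open>Membership in \<open>Bij D\<close> includes extensionality, so this set can coincide
  with the carrier of \<open>DimonoidAut M\<close> instead of merely corresponding to it.\<close>

definition block_perms :: "'a set \<Rightarrow> 'a set \<Rightarrow> 'a set \<Rightarrow> ('a \<Rightarrow> 'a) set" where
  "block_perms D P Q =
     {s \<in> Bij D. s ` P = P \<and> s ` Q = Q \<and> (\<forall>x\<in>D - (P \<union> Q). s x = x)}"

lemma restrict_Bij:
  assumes "s \<in> Bij D" "P \<subseteq> D" "s ` P = P"
  shows "restrict s P \<in> Bij P"
  using assms by (auto simp: Bij_def bij_betw_def inj_on_restrict_eq intro: inj_on_subset)

text \<open>Supplies the preimages for surjectivity in \<open>block_perms_iso\<close>. The map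
  \<open>s\<close> is bijective on each of three disjoint pieces: \<open>P\<close>, \<open>Q\<close>
  and the rest of \<open>D\<close>.\<close>

lemma glue_in_block_perms:
  assumes "p \<in> Bij P" "q \<in> Bij Q" "P \<subseteq> D" "Q \<subseteq> D" "P \<inter> Q = {}"
  defines "s \<equiv> \<lambda>x\<in>D. if x \<in> P then p x else if x \<in> Q then q x else x"
  shows "s \<in> block_perms D P Q"
proof -
  have D: "(P \<union> Q) \<union> (D - (P \<union> Q)) = D"
    using assms by auto
  have bP: "bij_betw s P P"
    using assms by (subst bij_betw_cong[where g = p]) (auto simp: Bij_def)
  have bQ: "bij_betw s Q Q"
    using assms by (subst bij_betw_cong[where g = q]) (auto simp: Bij_def)
  have fixR: "s x = x" if "x \<in> D - (P \<union> Q)" for x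
    using that by (simp add: s_def)
  have bR: "bij_betw s (D - (P \<union> Q)) (D - (P \<union> Q))"
    using fixR by (subst bij_betw_cong[where g = id]) auto
  have "bij_betw s ((P \<union> Q) \<union> (D - (P \<union> Q))) ((P \<union> Q) \<union> (D - (P \<union> Q)))"
    using bP bQ bR assms by (intro bij_betw_combine) auto
  then have "s \<in> Bij D"
    unfolding D by (simp add: Bij_def s_def)
  then show ?thesis
    using fixR bij_betw_imp_surj_on[OF bP] bij_betw_imp_surj_on[OF bQ]
    by (simp add: block_perms_def)
qed

text \<open>Being the identity off \<open>P\<close> and \<open>Q\<close>, a member of
  \<open>block_perms D P Q\<close> is determined by its two restrictions, and any pair of
  permutations glues. Restriction respects composition because both blocks are invariant.\<close>

lemma block_perms_iso:
  assumes PD: "P \<subseteq> D" and QD: "Q \<subseteq> D" and PQ: "P \<inter> Q = {}"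
  shows "BijGroup D \<lparr>carrier := block_perms D P Q\<rparr> \<cong> BijGroup P \<times>\<times> BijGroup Q"
    (is "?G \<cong> ?H")
proof -
  let ?h = "\<lambda>s. (restrict s P, restrict s Q)"
  have res: "restrict s P \<in> Bij P" "restrict s Q \<in> Bij Q" if "s \<in> block_perms D P Q" for s
    using that PD QD by (auto simp: block_perms_def intro!: restrict_Bij)
  have hom: "?h \<in> hom ?G ?H"
  proof (rule homI)
    fix s t assume "s \<in> carrier ?G" "t \<in> carrier ?G"
    then have st: "s \<in> block_perms D P Q" "t \<in> block_perms D P Q" by simp_all
    have "restrict (compose D s t) X = compose X (restrict s X) (restrict t X)"
      if "X \<subseteq> D" "t ` X = X" for X
    proof
      fix x
      have "t x \<in> X" if "x \<in> X"
        using that \<open>t ` X = X\<close> by blast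
      then show "restrict (compose D s t) X x = compose X (restrict s X) (restrict t X) x"
        using \<open>X \<subseteq> D\<close> by (auto simp: compose_def)
    qed
    moreover have "t ` P = P" "t ` Q = Q" "s \<in> Bij D" "t \<in> Bij D"
      using st by (simp_all add: block_perms_def)
    ultimately show "?h (s \<otimes>\<^bsub>?G\<^esub> t) = ?h s \<otimes>\<^bsub>?H\<^esub> ?h t"
      using st res PD QD by (simp add: BijGroup_def)
  qed (use res in \<open>auto simp: BijGroup_def\<close>)
  have inj: "inj_on ?h (block_perms D P Q)"
  proof (rule inj_onI)
    fix s t assume st: "s \<in> block_perms D P Q" "t \<in> block_perms D P Q" and eq: "?h s = ?h t"
    have "s x = t x" if "x \<in> D" for x
    proof -
      consider "x \<in> P" | "x \<in> Q" | "x \<in> D - (P \<union> Q)"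
        using \<open>x \<in> D\<close> by blast
      then show ?thesis
      proof cases
        case 1
        then show ?thesis using eq by (metis prod.inject restrict_apply')
      next
        case 2
        then show ?thesis using eq by (metis prod.inject restrict_apply')
      next
        case 3
        then show ?thesis using st by (simp add: block_perms_def)
      qed
    qed
    moreover have "s \<in> extensional D" "t \<in> extensional D"
      using st by (simp_all add: block_perms_def Bij_def)
    ultimately show "s = t"
      by (intro extensionalityI)
  qed
  have "(p, q) \<in> ?h ` block_perms D P Q" if "p \<in> Bij P" "q \<in> Bij Q" for p q
  proof (rule image_eqI)
    let ?s = "\<lambda>x\<in>D. if x \<in> P then p x else if x \<in> Q then q x else x"
    show "?s \<in> block_perms D P Q"
      using that assms by (rule glue_in_block_perms)
    have "restrict ?s P = p" "restrict ?s Q = q"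
      using that assms by (auto simp: fun_eq_iff restrict_def Bij_def extensional_def)
    then show "(p, q) = ?h ?s" by simp
  qed
  then have "?h ` carrier ?G = carrier ?H"
    using res by (auto simp: BijGroup_def)
  then have "?h \<in> iso ?G ?H"
    using hom inj by (simp add: iso_def bij_betw_def)
  then show ?thesis
    by (auto simp: is_iso_def)
qed

theorem theorem3p1:
  fixes D A B :: "'a set" and a b c :: 'a and M :: "'a dimonoid"
  assumes "A \<subseteq> D" and "B \<subseteq> D"
    and "A \<approx> B" and "{..<2::nat} \<lesssim> A"
    and "c \<in> A \<inter> B"
    and "a \<in> A" and "b \<in> B" and "a \<noteq> b"
    and "A - {a} = B - {b}"
  defines "M \<equiv> \<lparr>carrier = D,
                ldash = (\<lambda>x y. if x \<in> A then x else c),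
                rdash = (\<lambda>x y. if y \<in> B then y else c)\<rparr>"
  shows "dimonoid M \<and> iso_dual M \<and> \<not> dimonoid_abelian M \<and> \<not> dimonoid_commutative M \<and>
         dimonoid_rectangular M \<and> halo M = {} \<and>
         DimonoidAut M \<cong> BijGroup (A - {a, c}) \<times>\<times> BijGroup (D - (A \<union> B))"
proof -
  have AB: "x \<in> A \<longleftrightarrow> x \<in> B" if "x \<noteq> a" "x \<noteq> b" for x
    using assms(9) that by auto
  \<comment> \<open>Otherwise \<open>a\<close> would lie in \<open>B - {b} = A - {a}\<close>;
    symmetrically for \<open>b\<close>. Hence \<open>c\<close>, lying in both sets, differs from
    \<open>a\<close> and \<open>b\<close>.\<close>
  have aB: "a \<notin> B" and bA: "b \<notin> A"
    using assms(6-9) by auto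
  have mem: "a \<in> D" "b \<in> D" "c \<in> D" "c \<in> A" "c \<in> B" "c \<noteq> a" "c \<noteq> b"
    using assms aB bA by auto
  have M: "carrier M = D" "x \<stileturn>\<^bsub>M\<^esub> y = (if x \<in> A then x else c)"
    "x \<turnstile>\<^bsub>M\<^esub> y = (if y \<in> B then y else c)" for x y
    by (simp_all add: M_def)
  \<comment> \<open>In terms of the two retractions, \<open>D2\<close> says that they commute; the
    two associative laws, \<open>D1\<close> and \<open>D3\<close> reduce to idempotence.\<close>
  have dim: "dimonoid M"
    using AB mem by unfold_locales (auto simp: M)
  have dual: "iso_dual M"
  proof -
    have "bij_betw (Transposition.transpose a b) D D"
      using mem by (simp add: bij_betw_def)
    then have "Transposition.transpose a b \<in> dimonoid_iso M (dual_dimonoid M)"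
      using AB aB bA mem assms(6-8)
      by (auto simp: dimonoid_iso_def dual_dimonoid_def M Transposition.transpose_def)
    then show ?thesis
      by (auto simp: iso_dual_def)
  qed
  \<comment> \<open>Abelian would mean that the two retractions coincide, but at \<open>a\<close>
    they take the values \<open>a\<close> and \<open>c\<close>.\<close>
  have "\<not> dimonoid_abelian M"
    using mem aB assms(6) by (auto simp: dimonoid_abelian_def M)
  moreover have "\<not> dimonoid_commutative M"
    using mem assms(6) by (auto simp: dimonoid_commutative_def commutative_on_def M)
  moreover have "dimonoid_rectangular M"
    using mem by (auto simp: dimonoid_rectangular_def rectangular_on_def M)
  \<comment> \<open>A bar-unit \<open>e\<close> would give \<open>e \<turnstile> a = a\<close>,
    whereas this product is \<open>c\<close> since \<open>a\<close> is outside
    \<open>B\<close>.\<close>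
  moreover have "halo M = {}"
    using mem aB by (auto simp: halo_def M)
  moreover have "DimonoidAut M \<cong> BijGroup (A - {a, c}) \<times>\<times> BijGroup (D - (A \<union> B))"
  proof -
    let ?P = "A - {a, c}" and ?Q = "D - (A \<union> B)"
    have R: "D - (?P \<union> ?Q) = {a, b, c}"
      using AB assms mem by blast
    have "dimonoid_iso M M \<inter> extensional D = block_perms D ?P ?Q"
    proof (intro equalityI subsetI)
      fix s assume "s \<in> dimonoid_iso M M \<inter> extensional D"
      then have s: "s \<in> Bij D" and bij: "bij_betw s D D"
        and f: "\<And>x. x \<in> D \<Longrightarrow> s (if x \<in> A then x else c) = (if s x \<in> A then s x else c)"
        and g: "\<And>x. x \<in> D \<Longrightarrow> s (if x \<in> B then x else c) = (if s x \<in> B then s x else c)"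
        by (auto simp: dimonoid_iso_def Bij_def M)
      have eq: "s x = s y \<longleftrightarrow> x = y" if "x \<in> D" "y \<in> D" for x y
        using bij that by (auto simp: bij_betw_def inj_on_def)
      \<comment> \<open>The point \<open>b\<close> is outside \<open>A\<close>, so
        \<open>s c\<close> is either \<open>s b\<close> or \<open>c\<close>; injectivity rules out
        \<open>s b\<close>.\<close>
      have sc: "s c = c"
        using f[of b] bA mem eq[of b c] by (auto split: if_splits)
      \<comment> \<open>If \<open>x\<close> is outside \<open>A\<close> but \<open>s x\<close> is
        inside, then \<open>s x = c = s c\<close>, so \<open>x = c\<close>, which is in
        \<open>A\<close>. Conversely, for \<open>x\<close> in \<open>A\<close>, \<open>s x\<close>
        is fixed by the retraction onto \<open>A\<close>.\<close>
      have sA: "s x \<in> A \<longleftrightarrow> x \<in> A" if "x \<in> D" for x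
        using f[OF that] eq[OF that \<open>c \<in> D\<close>] mem sc by metis
      have sB: "s x \<in> B \<longleftrightarrow> x \<in> B" if "x \<in> D" for x
        using g[OF that] eq[OF that \<open>c \<in> D\<close>] mem sc by metis
      \<comment> \<open>\<open>a\<close> is the only element of \<open>A - B\<close>, a set that
        \<open>s\<close> preserves; likewise \<open>b\<close> for \<open>B - A\<close>.\<close>
      have sa: "s a = a"
        using sA[of a] sB[of a] AB[of "s a"] mem aB bA assms(6) by metis
      have sb: "s b = b"
        using sA[of b] sB[of b] AB[of "s b"] mem aB bA assms(7) by metis
      have im: "s ` X = X" if X: "X \<subseteq> D" and inv: "\<And>x. x \<in> D \<Longrightarrow> s x \<in> X \<longleftrightarrow> x \<in> X" for X
      proof (intro equalityI subsetI)
        fix y assume "y \<in> X"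
        then obtain x where "x \<in> D" "y = s x"
          using X bij by (auto simp: bij_betw_def)
        with inv \<open>y \<in> X\<close> show "y \<in> s ` X" by auto
      qed (use X inv in auto)
      have "s ` ?P = ?P"
        using assms(1) mem eq[of _ a] eq[of _ c] by (intro im) (auto simp: sA sa sc)
      moreover have "s ` ?Q = ?Q"
        using bij by (intro im) (auto simp: sA sB bij_betw_def)
      ultimately show "s \<in> block_perms D ?P ?Q"
        using s sa sb sc R by (simp add: block_perms_def)
    next
      fix s assume "s \<in> block_perms D ?P ?Q"
      then have s: "s \<in> Bij D" and P: "s ` ?P = ?P" and Q: "s ` ?Q = ?Q"
        and fixR: "s a = a" "s b = b" "s c = c"
        by (simp_all add: block_perms_def R)
      have sP: "s x \<in> ?P" if "x \<in> ?P" for x using P that by blast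
      have sQ: "s x \<in> ?Q" if "x \<in> ?Q" for x using Q that by blast
      have cases: "x \<in> ?P \<or> x \<in> ?Q \<or> x \<in> {a, b, c}" if "x \<in> D" for x
        using R that by blast
      \<comment> \<open>Preserving \<open>A\<close> and \<open>B\<close> and fixing the default
        value \<open>c\<close> is exactly what commuting with both retractions requires.\<close>
      have "s x \<in> A \<longleftrightarrow> x \<in> A" "s x \<in> B \<longleftrightarrow> x \<in> B" if "x \<in> D" for x
        using cases[OF that] sP[of x] sQ[of x] fixR AB[of x] AB[of "s x"] bA by auto
      then show "s \<in> dimonoid_iso M M \<inter> extensional D"
        using s fixR by (auto simp: dimonoid_iso_def Bij_def M)
    qed
    then have "DimonoidAut M = BijGroup D \<lparr>carrier := block_perms D ?P ?Q\<rparr>"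
      by (simp add: DimonoidAut_def M)
    moreover have "BijGroup D \<lparr>carrier := block_perms D ?P ?Q\<rparr> \<cong> BijGroup ?P \<times>\<times> BijGroup ?Q"
      using assms(1) by (intro block_perms_iso) auto
    ultimately show ?thesis by simp
  qed
  ultimately show ?thesis
    using dim dual by blast
qed

end
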